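(* Let $H$ be an affine semigroup of $\mathbb{N}^n$. The lattice of divisor-closed submonoids of $H$, the lattice of Archimedean components of $H$, and the lattice of faces of the polyhedral cone $\mathrm{L}_{\mathbb{Q}_+}(H)$ are isomorphic.
   Context: $\mathbb{N}$ denotes the nonnegative integers and $\mathbb{Q}_+$ the nonnegative rationals. An affine semigroup is a finitely generated submonoid of $(\mathbb{N}^n,+)$; submonoids contain $0$. For $a,b\in H$, write $b\leq_H a$ if $a=b+c$ for some $c\in H$. A submonoid $S$ of $H$ is divisor-closed if $a\in S$, $b\in H$, $b\leq_H a$ imply $b\in S$; the divisor-closed submonoids are ordered by inclusion. Define the congruence $\mathcal N$ on $H$ by: $a\,\mathcal N\, b$ if there exist $k,l\in\mathbb{N}\setminus\{0\}$ such that $b\leq_H ka$ and $a\leq_H lb$. The elements of $H/\mathcal N$ (equivalence classes, viewed as subsets of $H$) are the Archimedean components of $H$; they are ordered by $S_1\leq S_2$ if and only if $a+b\in S_2$ for every $a\in S_1$, $b\in S_2$. The rational cone of $H$ is $\mathrm{L}_{\mathbb{Q}_+}(H)=\{\sum_{i=1}^r\lambda_i h_i \mid r\in\mathbb{N},\ h_i\in H,\ \lambda_i\in\mathbb{Q}_+\}\subset\mathbb{Q}^n$. A face of a cone $\mathbf C\subset\mathbb{Q}^n$ is a non-empty set of the form $\mathrm{face}_\omega(\mathbf C)=\{x\in\mathbf C\mid x\cdot\omega\geq y\cdot\omega\text{ for all }y\in\mathbf C\}$ for some $\omega\in\mathbb{R}^n$ (dot product); faces are ordered by inclusion. *)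

theory Defs
  imports "HOL-Analysis.Analysis" "HOL-Algebra.Lattice"
begin

definition is_submonoid :: "('a::monoid_add) set \<Rightarrow> bool" where
  "is_submonoid S \<longleftrightarrow> 0 \<in> S \<and> (\<forall>a\<in>S. \<forall>b\<in>S. a + b \<in> S)"

definition affine_semigroup :: "(nat ^ 'n) set \<Rightarrow> bool" where
  "affine_semigroup H \<longleftrightarrow> (\<exists>A. finite A \<and> H = is_submonoid hull A)"

definition le_in :: "('a::monoid_add) set \<Rightarrow> 'a \<Rightarrow> 'a \<Rightarrow> bool" where
  "le_in H b a \<longleftrightarrow> (\<exists>c\<in>H. a = b + c)"

definition divisor_closed_submonoids :: "('a::monoid_add) set \<Rightarrow> 'a set set" where
  "divisor_closed_submonoids H =
    {S. is_submonoid S \<and> S \<subseteq> H \<and> (\<forall>a\<in>S. \<forall>b\<in>H. le_in H b a \<longrightarrow> b \<in> S)}"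

definition archimedean_congruence :: "(nat ^ 'n) set \<Rightarrow> ((nat ^ 'n) \<times> (nat ^ 'n)) set" where
  "archimedean_congruence H =
    {(a, b). a \<in> H \<and> b \<in> H \<and>
      (\<exists>k l :: nat. k \<noteq> 0 \<and> l \<noteq> 0 \<and> le_in H b (k *s a) \<and> le_in H a (l *s b))}"

definition archimedean_components :: "(nat ^ 'n) set \<Rightarrow> (nat ^ 'n) set set" where
  "archimedean_components H = H // archimedean_congruence H"

definition rat_vec :: "nat ^ 'n \<Rightarrow> rat ^ 'n" where
  "rat_vec h = (\<chi> i. of_nat (h $ i))"

definition rational_cone :: "(nat ^ 'n) set \<Rightarrow> (rat ^ 'n) set" where
  "rational_cone H =
    {\<Sum>i<r. lam i *s rat_vec (h i) | (r :: nat) lam h. \<forall>i<r. h i \<in> H \<and> 0 \<le> lam i}"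

definition real_vec :: "rat ^ 'n \<Rightarrow> real ^ 'n" where
  "real_vec x = (\<chi> i. of_rat (x $ i))"

definition face :: "real ^ 'n \<Rightarrow> (rat ^ 'n) set \<Rightarrow> (rat ^ 'n) set" where
  "face \<omega> C = {x \<in> C. \<forall>y\<in>C. real_vec x \<bullet> \<omega> \<ge> real_vec y \<bullet> \<omega>}"

definition faces :: "(rat ^ 'n) set \<Rightarrow> (rat ^ 'n) set set" where
  "faces C = {F. F \<noteq> {} \<and> (\<exists>\<omega>. F = face \<omega> C)}"

definition divisor_closed_order :: "(nat ^ 'n) set \<Rightarrow> (nat ^ 'n) set gorder" where
  "divisor_closed_order H =
    \<lparr>carrier = divisor_closed_submonoids H, eq = (=), le = (\<subseteq>)\<rparr>"

definition archimedean_order :: "(nat ^ 'n) set \<Rightarrow> (nat ^ 'n) set gorder" where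
  "archimedean_order H =
    \<lparr>carrier = archimedean_components H, eq = (=),
     le = (\<lambda>S1 S2. \<forall>a\<in>S1. \<forall>b\<in>S2. a + b \<in> S2)\<rparr>"

definition face_order :: "(rat ^ 'n) set \<Rightarrow> (rat ^ 'n) set gorder" where
  "face_order C = \<lparr>carrier = faces C, eq = (=), le = (\<subseteq>)\<rparr>"

text \<open>Between lattices, order isomorphisms are the same as lattice isomorphisms.\<close>

definition order_isomorphic :: "('a, 'c) gorder_scheme \<Rightarrow> ('b, 'd) gorder_scheme \<Rightarrow> bool" where
  "order_isomorphic L M \<longleftrightarrow>
    (\<exists>f. bij_betw f (carrier L) (carrier M) \<and> order_emb L M f)"

end

theory Submission
  imports Defs
begin

text \<open>
  Both the Archimedean components and the faces are represented by divisor-closed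
  submonoids. It suffices to map each of the two ordered sets bijectively onto the
  divisor-closed submonoids so that its order becomes inclusion. The divisor-closed
  submonoids themselves form a lattice, because they are closed under nonempty
  intersections and \<open>H\<close> is the largest of them.

  Components: let \<open>divisor_closure H a\<close> be the set of elements of \<open>H\<close> that divide some
  multiple of \<open>a\<close>, the divisor-closed submonoid generated by \<open>a\<close>. Two elements of \<open>H\<close> lie in
  the same component iff they have the same closure, so a component has a well-defined
  closure, and the order on components is inclusion of closures
  (\<open>component_le_iff\<close>). Every divisor-closed \<open>S\<close> arises: with \<open>A\<close> a finite generating set of \<open>H\<close>, it is
  the closure of the sum of \<open>A \<inter> S\<close> (\<open>divisor_closed_principal\<close>).

  Faces: a face \<open>F\<close> is sent to its trace, the set of elements of \<open>H\<close> lying in \<open>F\<close>. The functional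
  defining \<open>F\<close> is nonpositive on the cone and, within the cone, vanishes exactly on \<open>F\<close>, so the trace is
  divisor-closed. Every point of the cone has a positive integer multiple in \<open>H\<close>
  (\<open>rational_cone_iff\<close>), so \<open>F\<close> is determined by its trace. That every divisor-closed \<open>S\<close>
  is a trace is the convex-geometric core (\<open>divisor_closed_exposed\<close>). For each generator
  \<open>a \<notin> S\<close>, Farkas' lemma gives a functional that is nonpositive on \<open>H\<close>, zero on \<open>S\<close> and negative at
  \<open>a\<close>; the sum of these functionals vanishes on \<open>S\<close> and nowhere else on \<open>H\<close>. If there were no such
  functional, clearing denominators in the Farkas certificate would exhibit \<open>a\<close> as a divisor of an
  element of \<open>S\<close>. Farkas' lemma is proved over an arbitrary ordered field, so that the
  certificate has rational coefficients.
\<close>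

section \<open>Orders represented by set families\<close>

text \<open>Throughout this section \<open>g\<close> identifies an ordered set \<open>X\<close> with a family \<open>\<D>\<close> of sets ordered by
  inclusion. Order-theoretic statements about \<open>X\<close> then reduce to statements about \<open>\<D>\<close>.\<close>

lemma partial_order_via_sets:
  assumes "bij_betw g X \<D>"
    and "\<And>x y. x \<in> X \<Longrightarrow> y \<in> X \<Longrightarrow> r x y \<longleftrightarrow> g x \<subseteq> g y"
  shows "partial_order \<lparr>carrier = X, eq = (=), le = r\<rparr>"
proof -
  have inj: "inj_on g X"
    using assms(1) by (rule bij_betw_imp_inj_on)
  show ?thesis
    by unfold_locales (use assms(2) inj in \<open>auto simp: inj_on_eq_iff\<close>)
qed

lemma lattice_via_sets:
  assumes bij: "bij_betw g X \<D>"
    and r: "\<And>x y. x \<in> X \<Longrightarrow> y \<in> X \<Longrightarrow> r x y \<longleftrightarrow> g x \<subseteq> g y"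
    and Int: "\<And>A B. A \<in> \<D> \<Longrightarrow> B \<in> \<D> \<Longrightarrow> A \<inter> B \<in> \<D>"
    and hull: "\<And>A B. A \<in> \<D> \<Longrightarrow> B \<in> \<D> \<Longrightarrow>
      \<exists>C\<in>\<D>. A \<union> B \<subseteq> C \<and> (\<forall>D\<in>\<D>. A \<union> B \<subseteq> D \<longrightarrow> C \<subseteq> D)"
  shows "Lattice.lattice \<lparr>carrier = X, eq = (=), le = r\<rparr>"
    (is "Lattice.lattice ?L")
proof -
  interpret partial_order ?L
    using bij r by (rule partial_order_via_sets)
  have g: "g x \<in> \<D>" if "x \<in> X" for x
    using bij that by (auto simp: bij_betw_def)
  have onto: "\<exists>x\<in>X. g x = C" if "C \<in> \<D>" for C
    using bij that by (auto simp: bij_betw_def)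
  have sup: "\<exists>s. least ?L s (Upper ?L {x, y})" if xy: "x \<in> X" "y \<in> X" for x y
  proof -
    obtain C where C: "C \<in> \<D>" "g x \<union> g y \<subseteq> C" 
      "\<And>D. D \<in> \<D> \<Longrightarrow> g x \<union> g y \<subseteq> D \<Longrightarrow> C \<subseteq> D"
      using hull[OF g g] xy by meson
    obtain s where s: "s \<in> X" "g s = C"
      using onto C(1) by blast
    have "least ?L s (Upper ?L {x, y})"
    proof (rule least_UpperI)
      show "le ?L z s" if "z \<in> {x, y}" for z
        using that xy s r C(2) by auto
      show "le ?L s u" if "u \<in> Upper ?L {x, y}" for u
      proof -
        have u: "u \<in> X" "r x u" "r y u"
          using that xy by (auto simp: Upper_def)
        then have "g x \<union> g y \<subseteq> g u"
          using r xy by simp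
        then show ?thesis
          using C(3)[OF g] u(1) s r by simp
      qed
    qed (use xy s in auto)
    then show ?thesis ..
  qed
  have inf: "\<exists>i. greatest ?L i (Lower ?L {x, y})" if xy: "x \<in> X" "y \<in> X" for x y
  proof -
    obtain i where i: "i \<in> X" "g i = g x \<inter> g y"
      using onto Int[OF g g] xy by meson
    have "greatest ?L i (Lower ?L {x, y})"
    proof (rule greatest_LowerI)
      show "le ?L i z" if "z \<in> {x, y}" for z
        using that xy i r by auto
      show "le ?L u i" if "u \<in> Lower ?L {x, y}" for u
        using that xy i r by (auto simp: Lower_def)
    qed (use xy i in auto)
    then show ?thesis ..
  qed
  show ?thesis
    by unfold_locales (use sup inf in auto)
qed

lemma order_isomorphic_via_sets:
  assumes bij1: "bij_betw g1 X1 \<D>"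
    and r1: "\<And>x y. x \<in> X1 \<Longrightarrow> y \<in> X1 \<Longrightarrow> r1 x y \<longleftrightarrow> g1 x \<subseteq> g1 y"
    and bij2: "bij_betw g2 X2 \<D>"
    and r2: "\<And>x y. x \<in> X2 \<Longrightarrow> y \<in> X2 \<Longrightarrow> r2 x y \<longleftrightarrow> g2 x \<subseteq> g2 y"
  shows "order_isomorphic \<lparr>carrier = X1, eq = (=), le = r1\<rparr> \<lparr>carrier = X2, eq = (=), le = r2\<rparr>"
proof -
  interpret O1: partial_order "\<lparr>carrier = X1, eq = (=), le = r1\<rparr>"
    using bij1 r1 by (rule partial_order_via_sets)
  interpret O2: partial_order "\<lparr>carrier = X2, eq = (=), le = r2\<rparr>"
    using bij2 r2 by (rule partial_order_via_sets)
  define f where "f = inv_into X2 g2 \<circ> g1"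
  have bij: "bij_betw f X1 X2"
    unfolding f_def using bij1 bij_betw_inv_into[OF bij2] by (rule bij_betw_trans)
  have f: "f x \<in> X2" "g2 (f x) = g1 x" if "x \<in> X1" for x
    using that bij1 bij2 by (auto simp: f_def bij_betw_def inv_into_into f_inv_into_f)
  show ?thesis
    unfolding order_isomorphic_def order_emb_def
    using bij f r1 r2 O1.weak_partial_order_axioms O2.weak_partial_order_axioms
    by (intro exI[of _ f]) auto
qed

section \<open>Submonoids and divisibility\<close>

lemma is_submonoid_hull: "is_submonoid (is_submonoid hull A)"
  by (rule hull_in) (auto simp: is_submonoid_def)

lemma submonoid_smult:
  fixes a :: "nat ^ 'n"
  assumes "is_submonoid S" "a \<in> S"
  shows "k *s a \<in> S"
proof (induction k)
  case (Suc k)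
  have "Suc k *s a = a + k *s a"
    by (simp add: vec_eq_iff)
  then show ?case
    using Suc assms by (auto simp: is_submonoid_def)
qed (use assms in \<open>simp add: is_submonoid_def\<close>)

lemma submonoid_sum:
  fixes f :: "'i \<Rightarrow> 'a::comm_monoid_add"
  assumes "is_submonoid S" "\<And>i. i \<in> I \<Longrightarrow> f i \<in> S"
  shows "sum f I \<in> S"
  using assms(2)
  by (induction I rule: infinite_finite_induct)
    (use assms(1) in \<open>auto simp: is_submonoid_def\<close>)

lemma le_in_refl: "is_submonoid H \<Longrightarrow> le_in H a a"
  unfolding le_in_def is_submonoid_def by (metis add.right_neutral)

lemma le_in_trans:
  assumes "is_submonoid H" "le_in H a b" "le_in H b c"
  shows "le_in H a c"
proof -
  obtain x y where "x \<in> H" "b = a + x" "y \<in> H" "c = b + y"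
    using assms unfolding le_in_def by blast
  then have "c = a + (x + y)" "x + y \<in> H"
    using assms(1) by (auto simp: is_submonoid_def add.assoc)
  then show ?thesis
    unfolding le_in_def by blast
qed

lemma le_in_add:
  fixes a b c d :: "'a::comm_monoid_add"
  assumes "is_submonoid H" "le_in H a b" "le_in H c d"
  shows "le_in H (a + c) (b + d)"
proof -
  obtain x y where "x \<in> H" "b = a + x" "y \<in> H" "d = c + y"
    using assms unfolding le_in_def by blast
  then have "b + d = (a + c) + (x + y)" "x + y \<in> H"
    using assms(1) by (auto simp: is_submonoid_def ac_simps)
  then show ?thesis
    unfolding le_in_def by blast
qed

lemma divisor_closed_addD:
  fixes a b :: "'a::comm_monoid_add"
  assumes "S \<in> divisor_closed_submonoids H" "a \<in> H" "b \<in> H" "a + b \<in> S"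
  shows "a \<in> S" "b \<in> S"
proof -
  have "le_in H a (a + b)" "le_in H b (a + b)"
    using assms(2,3) unfolding le_in_def by (auto simp: add.commute)
  then show "a \<in> S" "b \<in> S"
    using assms unfolding divisor_closed_submonoids_def by blast+
qed

lemma divisor_closed_Inter:
  assumes "\<T> \<subseteq> divisor_closed_submonoids H" "\<T> \<noteq> {}"
  shows "\<Inter>\<T> \<in> divisor_closed_submonoids H"
  using assms unfolding divisor_closed_submonoids_def is_submonoid_def subset_iff
  by (simp; blast)

lemma divisor_closed_self: "is_submonoid H \<Longrightarrow> H \<in> divisor_closed_submonoids H"
  by (simp add: divisor_closed_submonoids_def)

text \<open>The elements of \<open>H\<close> that divide some multiple of \<open>a\<close>; for \<open>a \<in> H\<close> this is
  the divisor-closed submonoid generated by \<open>a\<close>.\<close>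

definition divisor_closure :: "(nat ^ 'n) set \<Rightarrow> nat ^ 'n \<Rightarrow> (nat ^ 'n) set" where
  "divisor_closure H a = {b \<in> H. \<exists>k. le_in H b (k *s a)}"

lemma divisor_closure_refl: "is_submonoid H \<Longrightarrow> a \<in> H \<Longrightarrow> a \<in> divisor_closure H a"
  using le_in_refl[of H a] unfolding divisor_closure_def
  by (intro CollectI conjI exI[of _ 1]) (simp_all del: One_nat_def)

lemma divisor_closure_closed:
  assumes H: "is_submonoid H"
  shows "divisor_closure H a \<in> divisor_closed_submonoids H"
proof -
  have "le_in H 0 (0 *s a)"
    using le_in_refl[OF H] by simp
  then have "0 \<in> divisor_closure H a"
    using H unfolding divisor_closure_def is_submonoid_def by blast
  moreover have "b + c \<in> divisor_closure H a"
    if bc: "b \<in> divisor_closure H a" "c \<in> divisor_closure H a" for b c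
  proof -
    obtain k l where "le_in H b (k *s a)" "le_in H c (l *s a)"
      using bc unfolding divisor_closure_def by blast
    then have "le_in H (b + c) ((k + l) *s a)"
      using le_in_add[OF H] by (simp add: vector_sadd_rdistrib)
    then show ?thesis
      using bc H unfolding divisor_closure_def is_submonoid_def by blast
  qed
  moreover have "c \<in> divisor_closure H a"
    if "b \<in> divisor_closure H a" "c \<in> H" "le_in H c b" for b c
    using that le_in_trans[OF H] unfolding divisor_closure_def by blast
  ultimately show ?thesis
    unfolding divisor_closed_submonoids_def is_submonoid_def
    by (auto simp: divisor_closure_def)
qed

lemma divisor_closure_least:
  assumes S: "S \<in> divisor_closed_submonoids H" and "a \<in> S"
  shows "divisor_closure H a \<subseteq> S"
proof -
  have "k *s a \<in> S" for k
    using assms submonoid_smult unfolding divisor_closed_submonoids_def by blast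
  then show ?thesis
    using S unfolding divisor_closure_def divisor_closed_submonoids_def by blast
qed

lemma divisor_closure_subset_iff:
  assumes "is_submonoid H" "a \<in> H"
  shows "divisor_closure H a \<subseteq> divisor_closure H b \<longleftrightarrow> a \<in> divisor_closure H b"
  using divisor_closure_least[OF divisor_closure_closed] divisor_closure_refl assms by blast

lemma divisor_closure_add:
  assumes "is_submonoid H" "a \<in> H" "b \<in> H"
  shows "divisor_closure H (a + b) = divisor_closure H b \<longleftrightarrow> a \<in> divisor_closure H b"
proof -
  have ab: "a + b \<in> H"
    using assms by (simp add: is_submonoid_def)
  have "a \<in> divisor_closure H (a + b)" "b \<in> divisor_closure H (a + b)"
    using divisor_closed_addD[OF divisor_closure_closed] divisor_closure_refl assms ab
    by blast+
  moreover have "a \<in> divisor_closure H b \<Longrightarrow> a + b \<in> divisor_closure H b"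
    using divisor_closure_closed[of H b] divisor_closure_refl[of H b] assms
    unfolding divisor_closed_submonoids_def is_submonoid_def by blast
  ultimately show ?thesis
    using divisor_closure_subset_iff assms ab by blast
qed

text \<open>Finite generation of \<open>H\<close> enters here: the sum of the generators of \<open>H\<close> lying in \<open>S\<close>
  generates \<open>S\<close> as a divisor-closed submonoid.\<close>

lemma divisor_closed_principal:
  assumes "affine_semigroup H" and S: "S \<in> divisor_closed_submonoids H"
  shows "\<exists>s\<in>S. S = divisor_closure H s"
proof -
  obtain A where A: "finite A" "H = is_submonoid hull A"
    using assms(1) by (auto simp: affine_semigroup_def)
  have H: "is_submonoid H"
    unfolding A(2) by (rule is_submonoid_hull)
  have AH: "A \<subseteq> H"
    unfolding A(2) by (rule hull_subset)
  have S_sub: "is_submonoid S" and SH: "S \<subseteq> H"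
    using S by (auto simp: divisor_closed_submonoids_def)
  define s where "s = \<Sum>(A \<inter> S)"
  have s: "s \<in> S"
    unfolding s_def by (rule submonoid_sum[OF S_sub]) simp
  let ?D = "divisor_closure H s"
  have D: "is_submonoid ?D"
    using divisor_closure_closed[OF H] by (simp add: divisor_closed_submonoids_def)
  have gen: "a \<in> ?D" if a: "a \<in> A" "a \<in> S" for a
  proof -
    have sum: "s = a + \<Sum>(A \<inter> S - {a})"
      unfolding s_def using a A(1) by (subst sum.remove[of _ a]) auto
    have "\<Sum>(A \<inter> S - {a}) \<in> H"
      by (rule submonoid_sum[OF H]) (use AH in blast)
    moreover have "s \<in> ?D"
      using divisor_closure_refl[OF H] s SH by blast
    ultimately show ?thesis
      using divisor_closed_addD[OF divisor_closure_closed[OF H]] a AH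
      by (metis subsetD sum)
  qed
  have "h \<in> H \<and> (h \<in> S \<longrightarrow> h \<in> ?D)" if "h \<in> H" for h
  proof (rule hull_induct[of h is_submonoid A])
    show "h \<in> is_submonoid hull A"
      using that A(2) by simp
    show "is_submonoid {h. h \<in> H \<and> (h \<in> S \<longrightarrow> h \<in> ?D)}"
      using H D divisor_closed_addD[OF S] unfolding is_submonoid_def by blast
  qed (use gen AH in blast)
  then have "S \<subseteq> ?D"
    using SH by blast
  then show ?thesis
    using divisor_closure_least[OF S s] s by blast
qed

section \<open>Archimedean components\<close>

lemma archimedean_congruence_iff:
  assumes H: "is_submonoid H"
  shows "(a, b) \<in> archimedean_congruence H \<longleftrightarrow>
    a \<in> H \<and> b \<in> H \<and> divisor_closure H a = divisor_closure H b"
proof -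
  \<comment> \<open>The multiplier may be taken positive, since \<open>b\<close> divides \<open>k a\<close> implies \<open>b\<close> divides \<open>(k + 1) a\<close>.\<close>
  have pos: "a \<in> divisor_closure H b \<longleftrightarrow> (\<exists>k. k \<noteq> 0 \<and> le_in H a (k *s b))"
    if "a \<in> H" "b \<in> H" for a b
  proof -
    have "le_in H a (Suc k *s b)" if "le_in H a (k *s b)" for k
    proof -
      have "le_in H 0 b"
        using \<open>b \<in> H\<close> by (auto simp: le_in_def)
      then have "le_in H (a + 0) (k *s b + b)"
        using le_in_add[OF H] that by blast
      moreover have "k *s b + b = Suc k *s b"
        by (simp add: vec_eq_iff)
      ultimately show ?thesis
        by simp
    qed
    then show ?thesis
      using that unfolding divisor_closure_def by blast
  qed
  have "(a, b) \<in> archimedean_congruence H \<longleftrightarrow> a \<in> H \<and> b \<in> H \<and>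
    (\<exists>k. k \<noteq> 0 \<and> le_in H b (k *s a)) \<and> (\<exists>l. l \<noteq> 0 \<and> le_in H a (l *s b))"
    unfolding archimedean_congruence_def by simp blast
  also have "\<dots> \<longleftrightarrow> a \<in> H \<and> b \<in> H \<and> b \<in> divisor_closure H a \<and> a \<in> divisor_closure H b"
    using pos[of a b] pos[of b a] by (intro conj_cong refl) simp_all
  also have "\<dots> \<longleftrightarrow> a \<in> H \<and> b \<in> H \<and> divisor_closure H a = divisor_closure H b"
    using divisor_closure_subset_iff[OF H, of a b] divisor_closure_subset_iff[OF H, of b a]
    by (auto simp: set_eq_subset)
  finally show ?thesis .
qed

lemma equiv_archimedean_congruence:
  "is_submonoid H \<Longrightarrow> equiv H (archimedean_congruence H)"
proof (rule equivI)
  assume H: "is_submonoid H"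
  note iff = archimedean_congruence_iff[OF H]
  show "archimedean_congruence H \<subseteq> H \<times> H"
    by (auto simp: archimedean_congruence_def)
  show "refl_on H (archimedean_congruence H)"
    by (rule refl_onI) (simp add: iff)
  show "sym (archimedean_congruence H)"
    by (rule symI) (simp add: iff)
  show "trans (archimedean_congruence H)"
    by (rule transI) (simp add: iff)
qed

text \<open>The divisor-closed submonoid attached to an Archimedean component. All members of
  a component have the same closure, so the union avoids choosing a representative.\<close>

definition component_closure :: "(nat ^ 'n) set \<Rightarrow> (nat ^ 'n) set \<Rightarrow> (nat ^ 'n) set" where
  "component_closure H C = (\<Union>a\<in>C. divisor_closure H a)"

lemma component_closure_eq:
  assumes "is_submonoid H" "C \<in> archimedean_components H" "a \<in> C"
  shows "a \<in> H" "component_closure H C = divisor_closure H a"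
    "C = {b \<in> H. divisor_closure H b = divisor_closure H a}"
proof -
  obtain c where c: "c \<in> H" "C = archimedean_congruence H `` {c}"
    using assms(2) unfolding archimedean_components_def by (elim quotientE)
  then have "C = {b \<in> H. divisor_closure H c = divisor_closure H b}"
    using archimedean_congruence_iff[OF assms(1)] by auto
  then show "a \<in> H" "component_closure H C = divisor_closure H a"
    "C = {b \<in> H. divisor_closure H b = divisor_closure H a}"
    using assms(3) unfolding component_closure_def by auto
qed

lemma component_nonempty:
  assumes "is_submonoid H" "C \<in> archimedean_components H"
  shows "\<exists>a. a \<in> C"
  using in_quotient_imp_non_empty[OF equiv_archimedean_congruence] assms
  unfolding archimedean_components_def by blast

lemma component_le_iff:
  assumes H: "is_submonoid H"
    and C: "C \<in> archimedean_components H" and D: "D \<in> archimedean_components H"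
  shows "(\<forall>a\<in>C. \<forall>b\<in>D. a + b \<in> D) \<longleftrightarrow> component_closure H C \<subseteq> component_closure H D"
proof -
  obtain c d where c: "c \<in> C" and d: "d \<in> D"
    using component_nonempty H C D by blast
  have "a + b \<in> D \<longleftrightarrow> component_closure H C \<subseteq> component_closure H D"
    if "a \<in> C" "b \<in> D" for a b
  proof -
    note a = component_closure_eq[OF H C that(1)]
    note b = component_closure_eq[OF H D that(2)]
    have "a + b \<in> D \<longleftrightarrow> divisor_closure H (a + b) = divisor_closure H b"
      using a(1) b(1) H by (subst b(3)) (auto simp: is_submonoid_def)
    then show ?thesis
      using a b divisor_closure_add[OF H a(1) b(1)] divisor_closure_subset_iff[OF H a(1)]
      by simp
  qed
  then show ?thesis
    using c d by blast
qed

lemma bij_component_closure: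
  assumes "affine_semigroup H"
  shows "bij_betw (component_closure H) (archimedean_components H) (divisor_closed_submonoids H)"
proof -
  have H: "is_submonoid H"
    using assms is_submonoid_hull by (auto simp: affine_semigroup_def)
  show ?thesis
  proof (rule bij_betw_imageI)
    show "inj_on (component_closure H) (archimedean_components H)"
    proof (rule inj_onI)
      fix C D assume CD: "C \<in> archimedean_components H" "D \<in> archimedean_components H"
        "component_closure H C = component_closure H D"
      obtain c d where "c \<in> C" "d \<in> D"
        using component_nonempty H CD by blast
      note c = component_closure_eq(2,3)[OF H CD(1) \<open>c \<in> C\<close>]
      note d = component_closure_eq(2,3)[OF H CD(2) \<open>d \<in> D\<close>]
      have "divisor_closure H c = divisor_closure H d"
        using CD(3) c(1) d(1) by simp
      then show "C = D"
        by (subst c(2), subst d(2)) simp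
    qed
    show "component_closure H ` archimedean_components H = divisor_closed_submonoids H"
    proof (intro equalityI subsetI)
      fix S assume "S \<in> component_closure H ` archimedean_components H"
      then obtain C where C: "C \<in> archimedean_components H" "S = component_closure H C"
        by blast
      then obtain c where "c \<in> C"
        using component_nonempty[OF H] by blast
      then show "S \<in> divisor_closed_submonoids H"
        using component_closure_eq(2)[OF H C(1)] C(2) divisor_closure_closed[OF H] by simp
    next
      fix S assume S: "S \<in> divisor_closed_submonoids H"
      then obtain s where s: "s \<in> S" "S = divisor_closure H s"
        using divisor_closed_principal[OF assms] by blast
      then have "s \<in> H"
        using S by (auto simp: divisor_closed_submonoids_def)
      let ?C = "archimedean_congruence H `` {s}"
      have C: "?C \<in> archimedean_components H"
        unfolding archimedean_components_def using \<open>s \<in> H\<close> by (rule quotientI)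
      have "s \<in> ?C"
        using \<open>s \<in> H\<close> archimedean_congruence_iff[OF H] by auto
      then show "S \<in> component_closure H ` archimedean_components H"
        using component_closure_eq(2)[OF H C] s(2) C by blast
    qed
  qed
qed

section \<open>Farkas' lemma over an ordered field\<close>

text \<open>The dot product over an arbitrary commutative semiring, used here for rational vectors.\<close>

definition dot :: "('a::comm_semiring_0) ^ 'n \<Rightarrow> 'a ^ 'n \<Rightarrow> 'a" where
  "dot x y = (\<Sum>i\<in>UNIV. x $ i * y $ i)"

lemma dot_add: "dot (x + y) z = dot x z + dot y z" "dot z (x + y) = dot z x + dot z y"
  by (simp_all add: dot_def sum.distrib algebra_simps)

lemma dot_diff:
  fixes x y z :: "'a::comm_ring ^ 'n"
  shows "dot (x - y) z = dot x z - dot y z" "dot z (x - y) = dot z x - dot z y"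
  by (simp_all add: dot_def sum_subtractf algebra_simps)

lemma dot_smult: "dot (c *s x) y = c * dot x y" "dot x (c *s y) = c * dot x y"
  by (simp_all add: dot_def sum_distrib_left ac_simps)

lemma dot_zero: "dot 0 x = 0" "dot x 0 = 0"
  by (simp_all add: dot_def)

lemma dot_sum: "dot (\<Sum>i\<in>I. f i) x = (\<Sum>i\<in>I. dot (f i) x)"
  "dot x (\<Sum>i\<in>I. f i) = (\<Sum>i\<in>I. dot x (f i))"
  by (induction I rule: infinite_finite_induct) (auto simp: dot_zero dot_add)

lemma dot_minus:
  fixes x y :: "'a::comm_ring ^ 'n"
  shows "dot (- x) y = - dot x y" "dot x (- y) = - dot x y"
  by (simp_all add: dot_def sum_negf)

lemma dot_self_pos:
  fixes x :: "'a::linordered_field ^ 'n"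
  assumes "x \<noteq> 0"
  shows "dot x x > 0"
proof -
  obtain i where "x $ i \<noteq> 0"
    using assms by (auto simp: vec_eq_iff)
  then show ?thesis
    unfolding dot_def by (intro sum_pos2[of _ i]) (auto simp: zero_less_mult_iff)
qed

text \<open>If every solution \<open>x\<close> of the inequalities \<open>v i \<cdot> x \<le> 0\<close> satisfies \<open>g \<cdot> x \<le> 0\<close>, then \<open>g\<close> is a
  nonnegative combination of the \<open>v i\<close>. The proof by induction on the number of inequalities
  (due to Bartl) needs neither topology nor completeness. When the inequality
  with index \<open>j\<close> cannot be dropped, some \<open>z\<close> violates it and \<open>g \<cdot> z \<le> 0\<close> while satisfying
  the others; the induction hypothesis is applied to the restrictions of all functionals to
  the kernel of \<open>v j\<close>, onto which one projects along \<open>z\<close>.\<close>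

lemma farkas:
  fixes v :: "'i \<Rightarrow> 'a::linordered_field ^ 'n"
  assumes "finite I"
    and "\<And>x. (\<And>i. i \<in> I \<Longrightarrow> dot (v i) x \<le> 0) \<Longrightarrow> dot g x \<le> 0"
  shows "\<exists>\<mu>. (\<forall>i\<in>I. 0 \<le> \<mu> i) \<and> g = (\<Sum>i\<in>I. \<mu> i *s v i)"
  using assms
proof (induction I arbitrary: v g rule: finite_induct)
  case empty
  then have "dot g g \<le> 0"
    by blast
  then have "g = 0"
    using dot_self_pos[of g] by force
  then show ?case
    by simp
next
  case (insert j I)
  show ?case
  proof (cases "\<forall>x. (\<forall>i\<in>I. dot (v i) x \<le> 0) \<longrightarrow> dot g x \<le> 0")
    case True
    then obtain \<mu> where "\<forall>i\<in>I. 0 \<le> \<mu> i" "g = (\<Sum>i\<in>I. \<mu> i *s v i)"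
      using insert.IH[of v g] by blast
    moreover from this have "(\<Sum>i\<in>insert j I. (\<mu>(j := 0)) i *s v i) = g"
      using insert.hyps by (simp cong: sum.cong_simp) (rule sum.cong; auto)
    ultimately show ?thesis
      by (intro exI[of _ "\<mu>(j := 0)"]) auto
  next
    case False
    then obtain y where y: "\<And>i. i \<in> I \<Longrightarrow> dot (v i) y \<le> 0" "dot g y > 0"
      by (auto simp: not_le)
    have jy: "dot (v j) y > 0"
    proof (rule ccontr)
      assume "\<not> dot (v j) y > 0"
      then have "dot (v i) y \<le> 0" if "i \<in> insert j I" for i
        using that y(1) by (auto simp: not_less)
      then show False
        using insert.prems[of y] y(2) by force
    qed
    define z where "z = inverse (dot (v j) y) *s y"
    have z: "\<And>i. i \<in> I \<Longrightarrow> dot (v i) z \<le> 0" "dot g z > 0" "dot (v j) z = 1"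
      using y jy by (auto simp: z_def dot_smult mult_le_0_iff)
    \<comment> \<open>Pull all functionals back along the projection \<open>x \<mapsto> x - (v j \<cdot> x) z\<close> onto the kernel of \<open>v j\<close>.\<close>
    define p where "p u = u - dot u z *s v j" for u
    have p: "dot (p u) x = dot u (x - dot (v j) x *s z)" for u x
      by (simp add: p_def dot_diff dot_smult)
    have "dot (p g) x \<le> 0" if "\<And>i. i \<in> I \<Longrightarrow> dot (p (v i)) x \<le> 0" for x
    proof -
      have "dot (v i) (x - dot (v j) x *s z) \<le> 0" if "i \<in> insert j I" for i
        using that \<open>\<And>i. i \<in> I \<Longrightarrow> dot (p (v i)) x \<le> 0\<close> z(3)
        by (auto simp: p) (simp add: dot_diff dot_smult)
      then show ?thesis
        unfolding p using insert.prems by blast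
    qed
    then obtain \<mu> where \<mu>: "\<forall>i\<in>I. 0 \<le> \<mu> i" "p g = (\<Sum>i\<in>I. \<mu> i *s p (v i))"
      using insert.IH[of "\<lambda>i. p (v i)" "p g"] by blast
    \<comment> \<open>\<open>c\<close> is the coefficient of \<open>v j\<close>, found by evaluating both sides at \<open>z\<close>.\<close>
    define c where "c = dot g z - (\<Sum>i\<in>I. \<mu> i * dot (v i) z)"
    have "(\<Sum>i\<in>I. \<mu> i * dot (v i) z) \<le> 0"
      using \<mu>(1) z(1) by (intro sum_nonpos) (auto simp: mult_le_0_iff)
    then have c: "c \<ge> 0"
      using z(2) by (simp add: c_def)
    have "(\<Sum>i\<in>I. \<mu> i *s p (v i)) = (\<Sum>i\<in>I. \<mu> i *s v i) - (\<Sum>i\<in>I. \<mu> i * dot (v i) z) *s v j"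
      by (simp add: p_def vec_eq_iff sum_subtractf sum_distrib_left algebra_simps)
    then have "g = c *s v j + (\<Sum>i\<in>I. \<mu> i *s v i)"
      using \<mu>(2) by (simp add: p_def c_def vec_eq_iff algebra_simps)
    also have "\<dots> = (\<Sum>i\<in>insert j I. (\<mu>(j := c)) i *s v i)"
      using insert.hyps by (simp cong: sum.cong_simp) (rule sum.cong; auto)
    finally show ?thesis
      using \<mu>(1) c by (intro exI[of _ "\<mu>(j := c)"]) auto
  qed
qed

section \<open>The rational cone\<close>

lemma rat_vec_add: "rat_vec (a + b) = rat_vec a + rat_vec b"
  by (simp add: rat_vec_def vec_eq_iff)

lemma rat_vec_zero: "rat_vec 0 = 0"
  by (simp add: rat_vec_def vec_eq_iff)

lemma rat_vec_smult: "rat_vec (k *s a) = of_nat k *s rat_vec a"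
  by (simp add: rat_vec_def vec_eq_iff)

lemma rat_vec_eq_iff: "rat_vec a = rat_vec b \<longleftrightarrow> a = b"
  by (simp add: rat_vec_def vec_eq_iff)

lemma rational_coneI:
  assumes "finite I" "\<And>i. i \<in> I \<Longrightarrow> 0 \<le> c i" "\<And>i. i \<in> I \<Longrightarrow> h i \<in> H"
  shows "(\<Sum>i\<in>I. c i *s rat_vec (h i)) \<in> rational_cone H"
proof -
  obtain e where e: "bij_betw e {..<card I} I"
    using ex_bij_betw_nat_finite[OF assms(1)] by (auto simp: atLeast0LessThan)
  have "(\<Sum>i\<in>I. c i *s rat_vec (h i)) = (\<Sum>k<card I. c (e k) *s rat_vec (h (e k)))"
    by (rule sum.reindex_bij_betw[OF e, symmetric])
  moreover have "\<forall>k<card I. h (e k) \<in> H \<and> 0 \<le> c (e k)"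
    using assms e by (auto dest: bij_betwE)
  ultimately show ?thesis
    unfolding rational_cone_def
    by (intro CollectI exI[of _ "card I"] exI[of _ "\<lambda>k. c (e k)"] exI[of _ "\<lambda>k. h (e k)"]) auto
qed

lemma rational_cone_smult_rat_vec:
  assumes "0 \<le> c" "h \<in> H"
  shows "c *s rat_vec h \<in> rational_cone H"
  using rational_coneI[of "{()}" "\<lambda>_. c" "\<lambda>_. h" H] assms by simp

lemma rat_vec_in_rational_cone: "h \<in> H \<Longrightarrow> rat_vec h \<in> rational_cone H"
  using rational_cone_smult_rat_vec[of 1] by simp

text \<open>Clearing denominators: a rational cone is the set of positive rational multiples of
  elements of the semigroup.\<close>

lemma rational_cone_iff:
  assumes H: "is_submonoid H"
  shows "x \<in> rational_cone H \<longleftrightarrow> (\<exists>N h. 0 < N \<and> h \<in> H \<and> of_nat N *s x = rat_vec h)"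
proof
  assume "\<exists>N h. 0 < N \<and> h \<in> H \<and> of_nat N *s x = rat_vec h"
  then obtain N h where N: "0 < (N::nat)" "h \<in> H" "of_nat N *s x = rat_vec h"
    by blast
  then have "x = inverse (of_nat N) *s rat_vec h"
    by (simp flip: N(3) add: vec_eq_iff)
  then show "x \<in> rational_cone H"
    using rational_cone_smult_rat_vec N(2) by (metis inverse_nonnegative_iff_nonnegative of_nat_0_le_iff)
next
  assume "x \<in> rational_cone H"
  then obtain r lam h where x: "x = (\<Sum>i<(r::nat). lam i *s rat_vec (h i))"
    and *: "\<forall>i<r. h i \<in> H \<and> 0 \<le> lam i"
    unfolding rational_cone_def by blast
  from * show "\<exists>N h. 0 < N \<and> h \<in> H \<and> of_nat N *s x = rat_vec h"
    unfolding x
  proof (induction r)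
    case 0
    then show ?case
      using H by (intro exI[of _ 1] exI[of _ 0]) (auto simp: is_submonoid_def rat_vec_zero)
  next
    case (Suc r)
    then obtain N a where N: "0 < N" "a \<in> H"
      "of_nat N *s (\<Sum>i<r. lam i *s rat_vec (h i)) = rat_vec a"
      by auto
    \<comment> \<open>Write the new coefficient as \<open>m / n\<close>.\<close>
    obtain p q where pq: "lam r = of_int p / of_int q" "q > 0"
      by (cases "lam r") (auto simp: Fract_of_int_quotient)
    moreover have "0 \<le> lam r"
      using Suc.prems by simp
    ultimately have "p \<ge> 0"
      by (simp add: zero_le_divide_iff)
    then obtain m n where mn: "of_nat n * lam r = of_nat m" "0 < n"
      using pq that[of "nat q" "nat p"] by (simp add: of_nat_nat)
    let ?b = "n *s a + (N * m) *s h r"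
    have "?b \<in> H"
      using H N(2) Suc.prems submonoid_smult[OF H] by (auto simp: is_submonoid_def)
    moreover have "of_nat (n * N) *s (\<Sum>i<Suc r. lam i *s rat_vec (h i)) = rat_vec ?b"
    proof -
      have "of_nat (n * N) *s (\<Sum>i<Suc r. lam i *s rat_vec (h i)) =
        of_nat n *s (of_nat N *s (\<Sum>i<r. lam i *s rat_vec (h i)))
        + (of_nat N * (of_nat n * lam r)) *s rat_vec (h r)"
        by (simp add: vec_eq_iff algebra_simps)
      then show ?thesis
        by (simp only: N(3) mn(1) rat_vec_add rat_vec_smult of_nat_mult)
    qed
    ultimately show ?case
      using N(1) mn(2) by (intro exI[of _ "n * N"] exI[of _ ?b]) auto
  qed
qed

section \<open>Faces of the rational cone\<close>

text \<open>The part of \<open>H\<close> lying in a set \<open>F\<close> of rational vectors, for \<open>F\<close> a face of the rational cone.\<close>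

definition face_trace :: "(nat ^ 'n) set \<Rightarrow> (rat ^ 'n) set \<Rightarrow> (nat ^ 'n) set" where
  "face_trace H F = {h \<in> H. rat_vec h \<in> F}"

lemma real_vec_add: "real_vec (x + y) = real_vec x + real_vec y"
  by (simp add: real_vec_def vec_eq_iff of_rat_add)

lemma real_vec_zero: "real_vec 0 = 0"
  by (simp add: real_vec_def vec_eq_iff)

lemma real_vec_smult: "real_vec (c *s x) = of_rat c *\<^sub>R real_vec x"
  by (simp add: real_vec_def vec_eq_iff of_rat_mult)

lemma inner_real_vec: "real_vec x \<bullet> real_vec y = of_rat (dot x y)"
  by (simp add: real_vec_def dot_def inner_vec_def of_rat_sum of_rat_mult)

lemma rational_cone_smult:
  assumes "is_submonoid H" "x \<in> rational_cone H"
  shows "of_nat k *s x \<in> rational_cone H"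
proof -
  obtain N h where N: "0 < N" "h \<in> H" "of_nat N *s x = rat_vec h"
    using assms rational_cone_iff by blast
  then have "of_nat N *s (of_nat k *s x) = rat_vec (k *s h)"
    by (simp add: rat_vec_smult flip: N(3))
  then show ?thesis
    using N submonoid_smult[OF assms(1)] rational_cone_iff[OF assms(1)] by blast
qed

text \<open>Because a cone contains the origin and is stable under doubling, the maximum that
  defines a nonempty face is zero.\<close>

lemma face_eq_kernel:
  assumes H: "is_submonoid H" and "face \<omega> (rational_cone H) \<noteq> {}"
  shows "face \<omega> (rational_cone H) = {x \<in> rational_cone H. real_vec x \<bullet> \<omega> = 0}"
    and "\<forall>y\<in>rational_cone H. real_vec y \<bullet> \<omega> \<le> 0"
proof -
  let ?C = "rational_cone H"
  have "0 \<in> H"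
    using H by (simp add: is_submonoid_def)
  then have zero: "0 \<in> ?C"
    using rat_vec_in_rational_cone rat_vec_zero by metis
  have max: "real_vec x \<bullet> \<omega> = 0" if "x \<in> face \<omega> ?C" for x
  proof -
    have x: "x \<in> ?C" "\<And>y. y \<in> ?C \<Longrightarrow> real_vec y \<bullet> \<omega> \<le> real_vec x \<bullet> \<omega>"
      using that by (auto simp: face_def)
    have "real_vec (of_nat 2 *s x) \<bullet> \<omega> \<le> real_vec x \<bullet> \<omega>"
      using x rational_cone_smult[OF H] by blast
    moreover have "0 \<le> real_vec x \<bullet> \<omega>"
      using x(2)[OF zero] by (simp add: real_vec_zero)
    ultimately show ?thesis
      by (simp add: real_vec_smult)
  qed
  obtain z where "z \<in> face \<omega> ?C"
    using assms(2) by blast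
  then show le: "\<forall>y\<in>?C. real_vec y \<bullet> \<omega> \<le> 0"
    using max[of z] by (auto simp: face_def)
  show "face \<omega> ?C = {x \<in> ?C. real_vec x \<bullet> \<omega> = 0}"
  proof (intro equalityI subsetI)
    fix x assume "x \<in> face \<omega> ?C"
    then show "x \<in> {x \<in> ?C. real_vec x \<bullet> \<omega> = 0}"
      using max[of x] by (simp add: face_def)
  next
    fix x assume "x \<in> {x \<in> ?C. real_vec x \<bullet> \<omega> = 0}"
    then show "x \<in> face \<omega> ?C"
      using le by (simp add: face_def)
  qed
qed

lemma face_mem_iff_multiple:
  assumes H: "is_submonoid H" and F: "F \<in> faces (rational_cone H)"
    and x: "x \<in> rational_cone H" and N: "0 < N" "h \<in> H" "of_nat N *s x = rat_vec h"
  shows "x \<in> F \<longleftrightarrow> h \<in> face_trace H F"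
proof -
  obtain \<omega> where \<omega>: "F = face \<omega> (rational_cone H)" "F \<noteq> {}"
    using F by (auto simp: faces_def)
  have "real_vec (rat_vec h) \<bullet> \<omega> = of_nat N * (real_vec x \<bullet> \<omega>)"
    by (simp flip: N(3) add: real_vec_smult)
  moreover have "F = {x \<in> rational_cone H. real_vec x \<bullet> \<omega> = 0}"
    using face_eq_kernel(1)[OF H, of \<omega>] \<omega> by simp
  ultimately show ?thesis
    using x N rat_vec_in_rational_cone[of h H] by (auto simp: face_trace_def)
qed

lemma face_subset_iff:
  assumes H: "is_submonoid H"
    and F: "F \<in> faces (rational_cone H)" and G: "G \<in> faces (rational_cone H)"
  shows "F \<subseteq> G \<longleftrightarrow> face_trace H F \<subseteq> face_trace H G"
proof
  assume trace: "face_trace H F \<subseteq> face_trace H G"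
  show "F \<subseteq> G"
  proof
    fix x assume "x \<in> F"
    then have x: "x \<in> rational_cone H"
      using F by (auto simp: faces_def face_def)
    then obtain N h where "0 < N" "h \<in> H" "of_nat N *s x = rat_vec h"
      using rational_cone_iff[OF H] by blast
    then show "x \<in> G"
      using face_mem_iff_multiple[OF H _ x] F G trace \<open>x \<in> F\<close> by blast
  qed
qed (auto simp: face_trace_def)

lemma face_trace_divisor_closed:
  assumes H: "is_submonoid H" and F: "F \<in> faces (rational_cone H)"
  shows "face_trace H F \<in> divisor_closed_submonoids H"
proof -
  obtain \<omega> where \<omega>: "F = face \<omega> (rational_cone H)" "F \<noteq> {}"
    using F by (auto simp: faces_def)
  define d where "d h = real_vec (rat_vec h) \<bullet> \<omega>" for h
  have le: "d h \<le> 0" if "h \<in> H" for h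
    using face_eq_kernel(2)[OF H] \<omega> that rat_vec_in_rational_cone by (auto simp: d_def)
  have trace: "face_trace H F = {h \<in> H. d h = 0}"
    using face_eq_kernel(1)[OF H] \<omega> rat_vec_in_rational_cone
    by (auto simp: face_trace_def d_def)
  have add: "d (a + b) = d a + d b" for a b
    by (simp add: d_def rat_vec_add real_vec_add inner_add_left)
  have "d 0 = 0"
    by (simp add: d_def rat_vec_zero real_vec_zero)
  then have "is_submonoid {h \<in> H. d h = 0}"
    using H by (simp add: is_submonoid_def add)
  moreover have "d b = 0" if b: "b \<in> H" "d a = 0" "le_in H b a" for a b
  proof -
    obtain c where c: "c \<in> H" "a = b + c"
      using b(3) by (auto simp: le_in_def)
    have "d b + d c = 0"
      using b(2) c(2) add[of b c] by simp
    then show ?thesis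
      using le[OF b(1)] le[OF c(1)] by linarith
  qed
  ultimately show ?thesis
    unfolding trace divisor_closed_submonoids_def by blast
qed

text \<open>A functional that is nonpositive on \<open>H\<close> and nonnegative at \<open>s\<close> vanishes at \<open>s\<close>, and hence on
  \<open>divisor_closure H s\<close>, so a single inequality at \<open>s\<close> suffices below. If no such functional
  exists, Farkas' lemma writes \<open>-a\<close> as a nonnegative rational combination of the generators and \<open>-s\<close>;
  after clearing denominators, a multiple of \<open>s\<close> is a positive multiple of \<open>a\<close> plus an
  element of \<open>H\<close>.\<close>

lemma separating_functional:
  assumes A: "finite A" "H = is_submonoid hull A"
    and S: "S \<in> divisor_closed_submonoids H" and a: "a \<in> H" "a \<notin> S" and s: "s \<in> S"
  shows "\<exists>w. (\<forall>b\<in>A. dot (rat_vec b) w \<le> 0) \<and> dot (rat_vec s) w \<ge> 0 \<and> dot (rat_vec a) w < 0"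
proof (rule ccontr)
  assume none: "\<not> ?thesis"
  have H: "is_submonoid H"
    unfolding A(2) by (rule is_submonoid_hull)
  have AH: "A \<subseteq> H"
    unfolding A(2) by (rule hull_subset)
  \<comment> \<open>The index \<open>None\<close> carries the extra constraint \<open>-s \<cdot> w \<le> 0\<close>.\<close>
  define v where "v = case_option (- rat_vec s) rat_vec"
  let ?I = "insert None (Some ` A)"
  have "dot (- rat_vec a) w \<le> 0" if "\<And>i. i \<in> ?I \<Longrightarrow> dot (v i) w \<le> 0" for w
  proof -
    have "dot (rat_vec s) w \<ge> 0"
      using that[of None] by (simp add: v_def dot_minus)
    moreover have "dot (rat_vec b) w \<le> 0" if "b \<in> A" for b
      using \<open>\<And>i. i \<in> ?I \<Longrightarrow> dot (v i) w \<le> 0\<close>[of "Some b"] that by (simp add: v_def)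
    ultimately show ?thesis
      using none by (auto simp: dot_minus not_less)
  qed
  then obtain \<mu> where \<mu>: "\<forall>i\<in>?I. 0 \<le> \<mu> i" "- rat_vec a = (\<Sum>i\<in>?I. \<mu> i *s v i)"
    using farkas[of ?I v "- rat_vec a"] A(1) by blast
  define x where "x = (\<Sum>b\<in>A. \<mu> (Some b) *s rat_vec b)"
  have "- rat_vec a = - (\<mu> None *s rat_vec s) + x"
    unfolding \<mu>(2) x_def v_def using A(1) by (simp add: sum.reindex)
  then have eq: "\<mu> None *s rat_vec s = rat_vec a + x"
    by (metis add.commute add_minus_cancel minus_add_cancel neg_eq_iff_add_eq_0)
  have "x \<in> rational_cone H"
    unfolding x_def by (rule rational_coneI) (use A(1) \<mu>(1) AH in auto)
  then obtain M h where M: "0 < M" "h \<in> H" "of_nat M *s x = rat_vec h"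
    using rational_cone_iff[OF H] by blast
  \<comment> \<open>Multiples of both sides of \<open>eq\<close> are integral: \<open>M\<close> clears the denominators of \<open>x\<close>, \<open>N\<close> those of the left-hand side.\<close>
  have "\<mu> None *s rat_vec s \<in> rational_cone S"
    by (rule rational_cone_smult_rat_vec) (use \<mu>(1) s in auto)
  then obtain N t where N: "0 < N" "t \<in> S" "of_nat N *s (\<mu> None *s rat_vec s) = rat_vec t"
    using rational_cone_iff S unfolding divisor_closed_submonoids_def by blast
  have "rat_vec (M *s t) = of_nat M *s (of_nat N *s (rat_vec a + x))"
    by (simp add: rat_vec_smult flip: N(3) eq)
  also have "\<dots> = of_nat (M * N) *s rat_vec a + of_nat N *s (of_nat M *s x)"
    by (simp add: vec_eq_iff algebra_simps)
  also have "\<dots> = rat_vec ((M * N) *s a + N *s h)"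
    by (simp only: M(3) rat_vec_add rat_vec_smult)
  finally have "M *s t = (M * N) *s a + N *s h"
    by (simp only: rat_vec_eq_iff)
  also have "\<dots> = a + ((M * N - 1) *s a + N *s h)"
    using M(1) N(1) by (cases "M * N") (auto simp: vec_eq_iff)
  finally have "M *s t = a + ((M * N - 1) *s a + N *s h)" .
  moreover have "M *s t \<in> S"
    using N(2) S submonoid_smult unfolding divisor_closed_submonoids_def by blast
  moreover have "(M * N - 1) *s a + N *s h \<in> H"
    using H submonoid_smult[OF H] a(1) M(2) unfolding is_submonoid_def by blast
  ultimately show False
    using divisor_closed_addD(1)[OF S] a by metis
qed

text \<open>Every divisor-closed submonoid is cut out of \<open>H\<close> by a rational linear functional that is
  nonpositive on \<open>H\<close>.\<close>

lemma divisor_closed_exposed: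
  assumes "affine_semigroup H" and S: "S \<in> divisor_closed_submonoids H"
  shows "\<exists>w. (\<forall>h\<in>H. dot (rat_vec h) w \<le> 0) \<and> S = {h \<in> H. dot (rat_vec h) w = 0}"
proof -
  obtain A where A: "finite A" "H = is_submonoid hull A"
    using assms(1) by (auto simp: affine_semigroup_def)
  have H: "is_submonoid H"
    unfolding A(2) by (rule is_submonoid_hull)
  have AH: "A \<subseteq> H"
    unfolding A(2) by (rule hull_subset)
  have SH: "S \<subseteq> H"
    using S by (simp add: divisor_closed_submonoids_def)
  obtain s where s: "s \<in> S" "S = divisor_closure H s"
    using divisor_closed_principal[OF assms] by blast
  have "\<forall>a\<in>A - S. \<exists>w. (\<forall>b\<in>A. dot (rat_vec b) w \<le> 0) \<and> dot (rat_vec s) w \<ge> 0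
      \<and> dot (rat_vec a) w < 0"
    using separating_functional[OF A S _ _ s(1)] AH by blast
  then obtain W where W: "\<And>a b. a \<in> A - S \<Longrightarrow> b \<in> A \<Longrightarrow> dot (rat_vec b) (W a) \<le> 0"
    "\<And>a. a \<in> A - S \<Longrightarrow> dot (rat_vec s) (W a) \<ge> 0"
    "\<And>a. a \<in> A - S \<Longrightarrow> dot (rat_vec a) (W a) < 0"
    by metis
  define w where "w = (\<Sum>a\<in>A - S. W a)"
  define d where "d h = dot (rat_vec h) w" for h
  have add: "d (a + b) = d a + d b" and zero: "d 0 = 0" for a b
    by (simp_all add: d_def rat_vec_add rat_vec_zero dot_add dot_zero)
  have s_ge: "d s \<ge> 0"
    unfolding d_def w_def dot_sum by (intro sum_nonneg W(2))
  have A_le: "d a \<le> 0" if "a \<in> A" for a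
    unfolding d_def w_def dot_sum by (intro sum_nonpos W(1) that)
  have A_less: "d a < 0" if "a \<in> A - S" for a
  proof -
    have "(\<Sum>b\<in>A - S. dot (rat_vec a) (W b)) < (\<Sum>b\<in>A - S. 0)"
    proof (rule sum_strict_mono_ex1)
      show "\<exists>b\<in>A - S. dot (rat_vec a) (W b) < 0"
        using W(3) that by blast
    qed (use A(1) W(1) that in auto)
    then show ?thesis
      by (simp add: d_def w_def dot_sum)
  qed
  have S_sub: "is_submonoid S"
    using S by (simp add: divisor_closed_submonoids_def)
  have main: "d h \<le> 0 \<and> (d h = 0 \<longrightarrow> h \<in> S)" if "h \<in> H" for h
  proof (rule hull_induct[of h is_submonoid A])
    show "h \<in> is_submonoid hull A"
      using that A(2) by simp
    show "d a \<le> 0 \<and> (d a = 0 \<longrightarrow> a \<in> S)" if "a \<in> A" for a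
      using A_le[OF that] A_less[of a] that by fastforce
    have "d (a + b) \<le> 0 \<and> (d (a + b) = 0 \<longrightarrow> a + b \<in> S)"
      if a: "d a \<le> 0 \<and> (d a = 0 \<longrightarrow> a \<in> S)" and b: "d b \<le> 0 \<and> (d b = 0 \<longrightarrow> b \<in> S)"
      for a b
    proof -
      have "d (a + b) = 0 \<longleftrightarrow> d a = 0 \<and> d b = 0"
        unfolding add using a b by (intro add_nonpos_eq_0_iff) blast+
      moreover have "d (a + b) \<le> 0"
        unfolding add using a b by (intro add_nonpos_nonpos) blast+
      ultimately show ?thesis
        using a b S_sub unfolding is_submonoid_def by blast
    qed
    then show "is_submonoid {h. d h \<le> 0 \<and> (d h = 0 \<longrightarrow> h \<in> S)}"
      using S_sub zero unfolding is_submonoid_def by simp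
  qed
  have "d h = 0" if h: "h \<in> S" for h
  proof -
    obtain k c where k: "c \<in> H" "k *s s = h + c"
      using h s(2) by (auto simp: divisor_closure_def le_in_def)
    have "d (k *s s) = of_nat k * d s"
      by (simp add: d_def rat_vec_smult dot_smult)
    then have "0 \<le> d (h + c)"
      using s_ge k(2) by (metis mult_nonneg_nonneg of_nat_0_le_iff)
    then have "0 \<le> d h + d c"
      unfolding add .
    then show ?thesis
      using main[OF k(1)] main[of h] h SH by fastforce
  qed
  then show ?thesis
    using main SH by (intro exI[of _ w]) (auto simp: d_def)
qed

lemma bij_face_trace:
  assumes "affine_semigroup H"
  shows "bij_betw (face_trace H) (faces (rational_cone H)) (divisor_closed_submonoids H)"
proof -
  have H: "is_submonoid H"
    using assms is_submonoid_hull by (auto simp: affine_semigroup_def)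
  let ?C = "rational_cone H"
  show ?thesis
  proof (rule bij_betw_imageI)
    show "inj_on (face_trace H) (faces ?C)"
      using face_subset_iff[OF H] by (intro inj_onI) blast
    have "S \<in> face_trace H ` faces ?C" if S: "S \<in> divisor_closed_submonoids H" for S
    proof -
      obtain w where w: "\<And>h. h \<in> H \<Longrightarrow> dot (rat_vec h) w \<le> 0"
        "S = {h \<in> H. dot (rat_vec h) w = 0}"
        using divisor_closed_exposed[OF assms S] by blast
      define F where "F = face (real_vec w) ?C"
      have le: "dot x w \<le> 0" if x: "x \<in> ?C" for x
      proof -
        obtain N h where N: "0 < N" "h \<in> H" "of_nat N *s x = rat_vec h"
          using rational_cone_iff[OF H] x by blast
        have "of_nat N * dot x w \<le> 0"
          using w(1)[OF N(2)] by (simp flip: N(3) add: dot_smult)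
        then show ?thesis
          using N(1) by (simp add: mult_le_0_iff)
      qed
      have zero: "0 \<in> ?C"
        using rat_vec_in_rational_cone[of 0 H] H by (simp add: rat_vec_zero is_submonoid_def)
      have "0 \<in> F"
        using le zero by (auto simp: F_def face_def inner_real_vec dot_zero)
      then have F: "F \<in> faces ?C" "face (real_vec w) ?C \<noteq> {}"
        by (auto simp: faces_def F_def)
      have "face_trace H F = S"
        unfolding F_def face_eq_kernel(1)[OF H F(2)] face_trace_def w(2)
        using rat_vec_in_rational_cone by (auto simp: inner_real_vec)
      then show ?thesis
        using F(1) by blast
    qed
    then show "face_trace H ` faces ?C = divisor_closed_submonoids H"
      using face_trace_divisor_closed[OF H] by blast
  qed
qed

section \<open>The three lattices\<close>

theorem corollary17:
  fixes H :: "(nat ^ 'n) set"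
  assumes "affine_semigroup H"
  shows "Lattice.lattice (divisor_closed_order H)
    \<and> Lattice.lattice (archimedean_order H)
    \<and> Lattice.lattice (face_order (rational_cone H))
    \<and> order_isomorphic (divisor_closed_order H) (archimedean_order H)
    \<and> order_isomorphic (archimedean_order H) (face_order (rational_cone H))
    \<and> order_isomorphic (divisor_closed_order H) (face_order (rational_cone H))"
proof -
  have H: "is_submonoid H"
    using assms is_submonoid_hull by (auto simp: affine_semigroup_def)
  let ?\<D> = "divisor_closed_submonoids H"
  have Int: "A \<inter> B \<in> ?\<D>" if "A \<in> ?\<D>" "B \<in> ?\<D>" for A B
    using divisor_closed_Inter[of "{A, B}" H] that by simp
  have hull: "\<exists>C\<in>?\<D>. A \<union> B \<subseteq> C \<and> (\<forall>D\<in>?\<D>. A \<union> B \<subseteq> D \<longrightarrow> C \<subseteq> D)"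
    if "A \<in> ?\<D>" "B \<in> ?\<D>" for A B
  proof
    have "H \<in> {D \<in> ?\<D>. A \<union> B \<subseteq> D}"
      using that divisor_closed_self[OF H] by (auto simp: divisor_closed_submonoids_def)
    then show "\<Inter>{D \<in> ?\<D>. A \<union> B \<subseteq> D} \<in> ?\<D>"
      by (intro divisor_closed_Inter) auto
  qed blast
  have D: "bij_betw id ?\<D> ?\<D>" "\<And>A B. A \<in> ?\<D> \<Longrightarrow> B \<in> ?\<D> \<Longrightarrow> A \<subseteq> B \<longleftrightarrow> id A \<subseteq> id B"
    by auto
  note A = bij_component_closure[OF assms] component_le_iff[OF H]
  note F = bij_face_trace[OF assms] face_subset_iff[OF H]
  show ?thesis
    unfolding divisor_closed_order_def archimedean_order_def face_order_def
    by (intro conjI lattice_via_sets[OF D Int hull] lattice_via_sets[OF A Int hull]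
        lattice_via_sets[OF F Int hull] order_isomorphic_via_sets[OF D A]
        order_isomorphic_via_sets[OF A F] order_isomorphic_via_sets[OF D F])
qed

end
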